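(* Assume the following regularity property of the modular Burgers' equation $u_t=u_{xx}+|u|_x$: for every $v_0\in C^1_{\mathrm{ub}}(\mathbb{R})$ converging to nonzero limits at $\pm\infty$, the global mild solution $v\in C([0,\infty),C_{\mathrm{ub}}(\mathbb{R}))$ with $v(0,\cdot)=v_0$ satisfies $v\in C^1((0,\infty)\times\mathbb{R},\mathbb{R})$, $v(t,\cdot)$ is piecewise $C^2$ for $t\ge0$, and across any interface $x=\xi(t)$ (zero of $v(t,\cdot)$) the jump condition $v_{xx}(t,\xi(t)^+)-v_{xx}(t,\xi(t)^-)=-2|v_x(t,\xi(t))|$ holds. Take $\phi_*>0$ and $x_0,x_1\in\mathbb{R}$ with $0<x_1-x_0<\tfrac16$. Let $\phi\colon\mathbb{R}\to\mathbb{R}$ be the odd function given by $\phi(x)=\phi_*(e^{-x}-1)$ for $x\ge0$. Let $u_0\in C^1_{\mathrm{ub}}(\mathbb{R})$ satisfy $\phi(x-x_0)\le u_0(x)\le\phi(x-x_1)$ for all $x\in\mathbb{R}$, and let $u\in C([0,\infty),C_{\mathrm{ub}}(\mathbb{R}))$ be the global mild solution of $u_t=u_{xx}+|u|_x$ with $u(0,\cdot)=u_0$. Then $u(t,\cdot)$ cannot possess two consecutive simple zeros $\xi_1(t),\xi_2(t)$ that exist for all $t\ge0$.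
   Context: $C_{\mathrm{ub}}(\mathbb{R})$ is the space of bounded uniformly continuous functions with the sup-norm; $C^1_{\mathrm{ub}}(\mathbb{R})$ the space of $C^1$ functions $g$ with $g,g'\in C_{\mathrm{ub}}(\mathbb{R})$. The global mild solution of $u_t=u_{xx}+|u|_x$ with initial datum $u_0$ is the unique $u\in C([0,\infty),C_{\mathrm{ub}}(\mathbb{R}))$ satisfying $u(t,\cdot)=e^{\partial_x^2 t}u_0+\int_0^t\partial_x e^{\partial_x^2(t-s)}|u(s,\cdot)|\,ds$, where $(e^{\partial_x^2 t}g)(x)=\int_{\mathbb{R}}(4\pi t)^{-1/2}e^{-(x-y)^2/(4t)}g(y)\,dy$. Note that $\phi(x)\to\mp\phi_*$ as $x\to\pm\infty$. *)

theory Defs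
  imports "HOL-Analysis.Analysis"
begin

definition Cub :: "(real \<Rightarrow> real) \<Rightarrow> bool" where
  "Cub g \<longleftrightarrow> bounded (range g) \<and> uniformly_continuous_on UNIV g"

definition C1ub :: "(real \<Rightarrow> real) \<Rightarrow> bool" where
  "C1ub g \<longleftrightarrow> (\<forall>x. g differentiable (at x)) \<and> Cub g \<and> Cub (deriv g)"

definition heat_sg :: "real \<Rightarrow> (real \<Rightarrow> real) \<Rightarrow> real \<Rightarrow> real" where
  "heat_sg t g x =
     (\<integral>y. (4 * pi * t) powr (-1/2) * exp (- ((x - y)^2) / (4 * t)) * g y \<partial>lborel)"

definition dx_heat_sg :: "real \<Rightarrow> (real \<Rightarrow> real) \<Rightarrow> real \<Rightarrow> real" where
  "dx_heat_sg t g x = deriv (\<lambda>z. heat_sg t g z) x"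

text \<open>Global mild solution of u_t = u_xx + |u|_x with initial datum u0;
  u t x is the value at time t \<ge> 0 and position x.\<close>
definition mild_solution :: "(real \<Rightarrow> real) \<Rightarrow> (real \<Rightarrow> real \<Rightarrow> real) \<Rightarrow> bool" where
  "mild_solution u0 u \<longleftrightarrow>
     (\<forall>t\<ge>0. Cub (u t)) \<and>
     (\<forall>t\<ge>0. \<forall>e>0. \<exists>d>0. \<forall>s\<ge>0. \<bar>s - t\<bar> < d \<longrightarrow> (\<forall>x. \<bar>u s x - u t x\<bar> \<le> e)) \<and>
     u 0 = u0 \<and>
     (\<forall>t>0. \<forall>x. u t x = heat_sg t u0 x +
         (LINT s:{0..t}|lborel. dx_heat_sg (t - s) (\<lambda>y. \<bar>u s y\<bar>) x))"

definition piecewise_C2 :: "(real \<Rightarrow> real) \<Rightarrow> bool" where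
  "piecewise_C2 f \<longleftrightarrow> continuous_on UNIV f \<and>
     (\<exists>S. (\<forall>x. \<exists>e>0. finite (S \<inter> ball x e)) \<and>
        (\<forall>x. x \<notin> S \<longrightarrow> f differentiable (at x) \<and> deriv f differentiable (at x)) \<and>
        continuous_on (- S) (deriv f) \<and> continuous_on (- S) (deriv (deriv f)) \<and>
        (\<forall>s\<in>S. (\<exists>l. (deriv f \<longlongrightarrow> l) (at_left s)) \<and> (\<exists>r. (deriv f \<longlongrightarrow> r) (at_right s)) \<and>
                (\<exists>l. (deriv (deriv f) \<longlongrightarrow> l) (at_left s)) \<and>
                (\<exists>r. (deriv (deriv f) \<longlongrightarrow> r) (at_right s))))"

definition C1_time_space :: "(real \<Rightarrow> real \<Rightarrow> real) \<Rightarrow> bool" where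
  "C1_time_space v \<longleftrightarrow>
     (\<exists>vt vx. (\<forall>t>0. \<forall>x. ((\<lambda>s. v s x) has_real_derivative vt t x) (at t) \<and>
                         ((\<lambda>y. v t y) has_real_derivative vx t x) (at x)) \<and>
        continuous_on ({0<..} \<times> UNIV) (\<lambda>p. v (fst p) (snd p)) \<and>
        continuous_on ({0<..} \<times> UNIV) (\<lambda>p. vt (fst p) (snd p)) \<and>
        continuous_on ({0<..} \<times> UNIV) (\<lambda>p. vx (fst p) (snd p)))"

definition mbe_regular :: "(real \<Rightarrow> real \<Rightarrow> real) \<Rightarrow> bool" where
  "mbe_regular v \<longleftrightarrow> C1_time_space v \<and>
     (\<forall>t>0. piecewise_C2 (v t)) \<and>
     (\<forall>t>0. \<forall>\<xi>. v t \<xi> = 0 \<longrightarrow>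
        (\<exists>Lp Lm. (deriv (deriv (v t)) \<longlongrightarrow> Lp) (at_right \<xi>) \<and>
                 (deriv (deriv (v t)) \<longlongrightarrow> Lm) (at_left \<xi>) \<and>
                 Lp - Lm = - 2 * \<bar>deriv (v t) \<xi>\<bar>))"

definition regularity_hypothesis :: bool where
  "regularity_hypothesis \<longleftrightarrow>
     (\<forall>v0 v. C1ub v0 \<and>
        (\<exists>a b. a \<noteq> 0 \<and> b \<noteq> 0 \<and> (v0 \<longlongrightarrow> a) at_top \<and> (v0 \<longlongrightarrow> b) at_bot) \<and>
        mild_solution v0 v \<longrightarrow> mbe_regular v)"

definition phi_prof :: "real \<Rightarrow> real \<Rightarrow> real" where
  "phi_prof phis x = (if x \<ge> 0 then phis * (exp (- x) - 1) else - (phis * (exp x - 1)))"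

definition simple_zero :: "(real \<Rightarrow> real) \<Rightarrow> real \<Rightarrow> bool" where
  "simple_zero f \<xi> \<longleftrightarrow> f \<xi> = 0 \<and> (\<exists>d. (f has_real_derivative d) (at \<xi>) \<and> d \<noteq> 0)"

end

theory Submission
  imports Defs "HOL-Probability.Distributions"
begin

text \<open>
  Already at time \<open>T = 1/64\<close> the solution has at most one zero. Write \<open>a\<close> for \<open>phis\<close> and let \<open>psi\<close> be
  the profile centred at the midpoint \<open>m\<close> of \<open>x0\<close> and \<open>x1\<close>, so that \<open>u0\<close> and \<open>psi\<close> differ by at
  most \<open>a/12\<close>. Since \<open>d/dx\<close> of the heat semigroup has norm \<open>1 / sqrt (pi t)\<close> on bounded functions and
  the absolute value is 1-Lipschitz, the increments \<open>u(t, x + h) - u(t, x)\<close> obey a closed singular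
  integral inequality; for \<open>t\<close> up to \<open>T\<close> they are at most \<open>a h (1.27 + 1 / (12 sqrt (pi t)))\<close>, and the
  Duhamel term at time \<open>T\<close> contributes at most \<open>0.27 a h\<close>. The heat flow of \<open>psi\<close> keeps a slope
  below \<open>- 0.73 a\<close> on the interval where \<open>u(T)\<close> can vanish, and the heat flow of \<open>u0 - psi\<close> has slope
  at most \<open>0.39 a\<close>. The three contributions sum to a negative slope, so two zeros cannot coexist.
\<close>

section \<open>The heat kernel\<close>

text \<open>Written as in the integrand of \<open>heat_sg\<close>, so that unfolding alone
  identifies the two.\<close>

definition heat_kernel :: "real \<Rightarrow> real \<Rightarrow> real" where
  "heat_kernel t z = (4 * pi * t) powr (-1/2) * exp (- (z\<^sup>2) / (4 * t))"

text \<open>Differentiation is in the space variable; the closed form reduces the L1 norm to a first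
  absolute moment.\<close>

definition heat_kernel' :: "real \<Rightarrow> real \<Rightarrow> real" where
  "heat_kernel' t z = - z / (2 * t) * heat_kernel t z"

lemma heat_kernel_nonneg: "0 \<le> heat_kernel t z"
  by (simp add: heat_kernel_def)

text \<open>Lets the mass and the first absolute moment be read off from the centred Gaussian of
  variance 2t.\<close>

lemma heat_kernel_normal_density:
  assumes "0 < t"
  shows "heat_kernel t z = normal_density 0 (sqrt (2 * t)) z"
proof -
  have "2 * pi * (sqrt (2 * t))\<^sup>2 = 4 * pi * t"
    using assms by simp
  then have "(4 * pi * t) powr (-1/2) = 1 / sqrt (2 * pi * (sqrt (2 * t))\<^sup>2)"
    using assms powr_minus_divide[of "4 * pi * t" "1/2"] powr_half_sqrt[of "4 * pi * t"] by simp
  then show ?thesis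
    using assms by (simp add: heat_kernel_def normal_density_def)
qed

lemma heat_kernel_measurable [measurable]:
  "case_prod heat_kernel \<in> borel_measurable (borel \<Otimes>\<^sub>M borel)"
  unfolding heat_kernel_def by measurable

lemma heat_kernel'_measurable [measurable]:
  "case_prod heat_kernel' \<in> borel_measurable (borel \<Otimes>\<^sub>M borel)"
  unfolding heat_kernel'_def by measurable

lemma has_bochner_integral_heat_kernel:
  assumes "0 < t"
  shows "has_bochner_integral lborel (heat_kernel t) 1"
proof -
  have "heat_kernel t = normal_density 0 (sqrt (2 * t))"
    using assms by (simp add: fun_eq_iff heat_kernel_normal_density)
  then show ?thesis
    using normal_moment_even[of "sqrt (2 * t)" 0 0] assms by simp
qed

lemma has_bochner_integral_abs_heat_kernel:
  assumes "0 < t"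
  shows "has_bochner_integral lborel (\<lambda>z. \<bar>z\<bar> * heat_kernel t z) (2 * sqrt t / sqrt pi)"
proof -
  have "sqrt (2 * t) * sqrt (2 / pi) = 2 * sqrt t / sqrt pi"
    using assms by (simp add: real_sqrt_mult real_sqrt_divide)
  then show ?thesis
    using normal_moment_abs_odd[of "sqrt (2 * t)" 0 0] assms
    by (simp add: heat_kernel_normal_density mult.commute cong: has_bochner_integral_cong)
qed

text \<open>The first absolute moment of the kernel divided by 2t; this norm is the source of the
  singular factors in the later time integrals.\<close>

lemma has_bochner_integral_abs_heat_kernel':
  assumes "0 < t"
  shows "has_bochner_integral lborel (\<lambda>z. \<bar>heat_kernel' t z\<bar>) (1 / (sqrt pi * sqrt t))"
proof -
  have eq: "2 * sqrt t / sqrt pi / (2 * t) = 1 / (sqrt pi * sqrt t)"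
    using assms by (simp add: field_simps)
  have "\<bar>heat_kernel' t z\<bar> = \<bar>z\<bar> * heat_kernel t z / (2 * t)" for z
    using assms by (simp add: heat_kernel'_def abs_mult heat_kernel_nonneg)
  then show ?thesis
    using has_bochner_integral_divide_zero[OF has_bochner_integral_abs_heat_kernel[OF assms],
        of "2 * t"]
    by (simp only: eq)
qed

lemma heat_kernel_has_real_derivative:
  assumes "0 < t"
  shows "(heat_kernel t has_real_derivative heat_kernel' t z) (at z)"
proof -
  have "((\<lambda>z. - (z\<^sup>2) / (4 * t)) has_real_derivative - z / (2 * t)) (at z)"
    using assms by (auto intro!: derivative_eq_intros)
  from DERIV_cmult[OF DERIV_fun_exp[OF this], of "(4 * pi * t) powr (-1/2)"]
  show ?thesis by (simp add: heat_kernel_def[abs_def] heat_kernel'_def mult_ac)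
qed

lemma integrable_mult_bounded:
  fixes k g :: "real \<Rightarrow> real"
  assumes "integrable lborel k" "g \<in> borel_measurable borel" "\<And>y. \<bar>g y\<bar> \<le> B"
  shows "integrable lborel (\<lambda>y. k y * g y)"
proof (rule Bochner_Integration.integrable_bound)
  show "integrable lborel (\<lambda>y. B * \<bar>k y\<bar>)"
    using assms(1) by simp
  show "(\<lambda>y. k y * g y) \<in> borel_measurable lborel"
    using assms(1,2) by (auto intro: borel_measurable_times)
  show "AE y in lborel. norm (k y * g y) \<le> norm (B * \<bar>k y\<bar>)"
  proof (rule AE_I2)
    fix y
    have "0 \<le> B" using assms(3)[of y] by linarith
    then show "norm (k y * g y) \<le> norm (B * \<bar>k y\<bar>)"
      using mult_left_mono[OF assms(3)[of y], of "\<bar>k y\<bar>"] by (simp add: abs_mult mult_ac)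
  qed
qed

lemma integrable_heat_kernel: "0 < t \<Longrightarrow> integrable lborel (heat_kernel t)"
  using has_bochner_integral_heat_kernel by (auto simp: has_bochner_integral_iff)

lemma integrable_heat_kernel': "0 < t \<Longrightarrow> integrable lborel (heat_kernel' t)"
  using has_bochner_integral_abs_heat_kernel'[of t]
  by (auto simp: has_bochner_integral_iff integrable_abs_iff)

lemma integral_reflect:
  fixes f :: "real \<Rightarrow> real"
  shows "(\<integral>y. f (x - y) \<partial>lborel) = (\<integral>z. f z \<partial>lborel)"
  using lborel_integral_real_affine[of "-1" f x] by simp

lemma heat_sg_convolution: "heat_sg t g x = (\<integral>z. heat_kernel t z * g (x - z) \<partial>lborel)"
  using integral_reflect[of "\<lambda>z. heat_kernel t z * g (x - z)" x]
  by (simp add: heat_sg_def heat_kernel_def)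

section \<open>Differentiation of the heat semigroup in space\<close>

text \<open>Supplies the majorant for differentiating under the integral: a shift by at most 1 costs
  only a constant factor once the kernel is widened to time 2t.\<close>

lemma heat_kernel_shift_le:
  assumes "0 < t" "\<bar>\<theta>\<bar> \<le> 1"
  shows "\<bar>heat_kernel' t (z + \<theta>)\<bar> \<le>
    (1 + \<bar>z\<bar>) * heat_kernel (2 * t) z * (sqrt 2 * exp (1 / (4 * t)) / (2 * t))"
proof -
  have "\<theta>\<^sup>2 \<le> 1" using assms(2) by (simp add: abs_square_le_1)
  \<comment> \<open>Half of this square equals
    \<open>(z + \<theta>)^2 - z^2 / 2 + \<theta>^2\<close>.\<close>
  moreover have "0 \<le> (z + 2 * \<theta>)\<^sup>2" by simp
  ultimately have "z\<^sup>2 / 2 - 1 \<le> (z + \<theta>)\<^sup>2"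
    by (simp add: power2_eq_square algebra_simps)
  then have "- ((z + \<theta>)\<^sup>2) / (4 * t) \<le> (1 - z\<^sup>2 / 2) / (4 * t)"
    using assms(1) by (intro divide_right_mono) auto
  also have "\<dots> = 1 / (4 * t) + - (z\<^sup>2) / (4 * (2 * t))"
    using assms(1) by (simp add: field_simps)
  finally have "exp (- ((z + \<theta>)\<^sup>2) / (4 * t)) \<le> exp (1 / (4 * t)) * exp (- (z\<^sup>2) / (4 * (2 * t)))"
    by (simp flip: exp_add)
  then have 1: "heat_kernel t (z + \<theta>) \<le>
      (4 * pi * t) powr (-1/2) * (exp (1 / (4 * t)) * exp (- (z\<^sup>2) / (4 * (2 * t))))"
    unfolding heat_kernel_def by (intro mult_left_mono) auto
  have "(4 * pi * t) powr (-1/2) = sqrt 2 * (4 * pi * (2 * t)) powr (-1/2)"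
  proof -
    have "sqrt (4 * pi * (2 * t)) = sqrt 2 * sqrt (4 * pi * t)"
      by (simp add: mult_ac flip: real_sqrt_mult)
    then show ?thesis
      using assms(1) by (simp add: powr_minus powr_half_sqrt)
  qed
  with 1 have 2: "heat_kernel t (z + \<theta>) \<le> sqrt 2 * exp (1 / (4 * t)) * heat_kernel (2 * t) z"
    by (simp add: heat_kernel_def mult_ac)
  have "\<bar>heat_kernel' t (z + \<theta>)\<bar> = \<bar>z + \<theta>\<bar> / (2 * t) * heat_kernel t (z + \<theta>)"
    using assms(1) by (simp only: heat_kernel'_def abs_mult abs_divide abs_minus_cancel
        abs_of_nonneg[OF heat_kernel_nonneg] abs_numeral abs_of_pos)
  also have "\<dots> \<le> (1 + \<bar>z\<bar>) / (2 * t) * (sqrt 2 * exp (1 / (4 * t)) * heat_kernel (2 * t) z)"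
    using assms 2 by (intro mult_mono divide_right_mono) (auto simp: heat_kernel_nonneg)
  finally show ?thesis by (simp add: mult_ac)
qed

text \<open>Dominated convergence for the difference quotients of the kernel; the derivative falls
  on the kernel because \<open>g\<close> is merely bounded and measurable.\<close>

lemma heat_sg_has_real_derivative:
  assumes t: "0 < t" and g [measurable]: "g \<in> borel_measurable borel" and B: "\<And>y. \<bar>g y\<bar> \<le> B"
  shows "(heat_sg t g has_real_derivative (\<integral>z. heat_kernel' t z * g (x - z) \<partial>lborel)) (at x)"
proof -
  define C where "C = sqrt 2 * exp (1 / (4 * t)) / (2 * t)"
  define w where "w = (\<lambda>y. (1 + \<bar>x - y\<bar>) * heat_kernel (2 * t) (x - y) * C)"
  have heat: "heat_sg t g x = (\<integral>y. heat_kernel t (x - y) * g y \<partial>lborel)" for x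
    by (simp add: heat_sg_def heat_kernel_def)
  have int: "integrable lborel (\<lambda>y. heat_kernel t (x - y) * g y)" for x
    using lborel_integrable_real_affine[OF integrable_heat_kernel[OF t], of "-1" x]
    by (intro integrable_mult_bounded[OF _ g B]) auto
  have "integrable lborel (\<lambda>z. heat_kernel (2 * t) z + \<bar>z\<bar> * heat_kernel (2 * t) z)"
    using has_bochner_integral_heat_kernel[of "2 * t"]
      has_bochner_integral_abs_heat_kernel[of "2 * t"] t
    by (auto simp: has_bochner_integral_iff)
  then have "integrable lborel (\<lambda>z. (1 + \<bar>z\<bar>) * heat_kernel (2 * t) z * C)"
    by (intro integrable_mult_left) (simp add: distrib_right)
  from lborel_integrable_real_affine[OF this, of "-1" x]
  have w: "integrable lborel (\<lambda>y. B * w y)"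
    by (simp add: w_def)
  have "B \<ge> 0" using B[of 0] by linarith
  define q where "q = (\<lambda>h y. (heat_kernel t (x + h - y) - heat_kernel t (x - y)) / h * g y)"
  \<comment> \<open>The mean value theorem moves the argument of the kernel by at most 1, the range
    covered by \<open>heat_kernel_shift_le\<close>.\<close>
  have q_le: "\<bar>q h y\<bar> \<le> B * w y" if "h \<noteq> 0" "\<bar>h\<bar> \<le> 1" for h y
  proof -
    have mvt: "\<exists>z. a < z \<and> z < b \<and>
        heat_kernel t b - heat_kernel t a = (b - a) * heat_kernel' t z" if "a < b" for a b
      using MVT2[OF that heat_kernel_has_real_derivative[OF t]] by blast
    obtain \<theta> where \<theta>: "\<bar>\<theta>\<bar> \<le> 1"
      "heat_kernel t (x + h - y) - heat_kernel t (x - y) = h * heat_kernel' t (x - y + \<theta>)"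
    proof (cases "h > 0")
      case True
      with mvt[of "x - y" "x + h - y"] obtain z where z: "x - y < z" "z < x + h - y"
        "heat_kernel t (x + h - y) - heat_kernel t (x - y) = h * heat_kernel' t z"
        by (auto simp: algebra_simps)
      show ?thesis
        by (rule that[of "z - (x - y)"]) (use z \<open>\<bar>h\<bar> \<le> 1\<close> in auto)
    next
      case False
      with mvt[of "x + h - y" "x - y"] \<open>h \<noteq> 0\<close> obtain z where z: "x + h - y < z" "z < x - y"
        "heat_kernel t (x - y) - heat_kernel t (x + h - y) = - h * heat_kernel' t z"
        by (auto simp: algebra_simps)
      show ?thesis
        by (rule that[of "z - (x - y)"]) (use z \<open>\<bar>h\<bar> \<le> 1\<close> in auto)
    qed
    then have "q h y = heat_kernel' t (x - y + \<theta>) * g y"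
      using \<open>h \<noteq> 0\<close> by (simp add: q_def)
    also have "\<bar>\<dots>\<bar> \<le> w y * B"
      unfolding abs_mult w_def C_def using heat_kernel_shift_le[OF t \<theta>(1)] B t
      by (intro mult_mono) (auto simp: heat_kernel_nonneg)
    finally show ?thesis by (simp add: mult.commute)
  qed
  have "((\<lambda>h. (heat_sg t g (x + h) - heat_sg t g x) / h)
      \<longlongrightarrow> (\<integral>y. heat_kernel' t (x - y) * g y \<partial>lborel)) (at 0)"
    unfolding tendsto_at_iff_sequentially comp_def
  proof safe
    fix X :: "nat \<Rightarrow> real"
    assume X0: "\<forall>i. X i \<in> UNIV - {0}" and X: "X \<longlonglongrightarrow> 0"
    have X0: "X i \<noteq> 0" for i using X0 by auto
    have "eventually (\<lambda>n. \<bar>X n\<bar> < 1) sequentially"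
      using tendstoD[OF X, of 1] by simp
    \<comment> \<open>The majorant is valid for increments up to 1, so dominated convergence is
      applied to the sequence shifted by \<open>N\<close>.\<close>
    then obtain N where N: "\<And>n. n \<ge> N \<Longrightarrow> \<bar>X n\<bar> < 1"
      by (auto simp: eventually_sequentially)
    have eq: "(heat_sg t g (x + X n) - heat_sg t g x) / X n = (\<integral>y. q (X n) y \<partial>lborel)" for n
    proof -
      have "(heat_sg t g (x + X n) - heat_sg t g x) / X n =
        (\<integral>y. (heat_kernel t (x + X n - y) * g y - heat_kernel t (x - y) * g y) / X n \<partial>lborel)"
        using int by (simp add: heat)
      also have "\<dots> = (\<integral>y. q (X n) y \<partial>lborel)"
        by (intro Bochner_Integration.integral_cong) (auto simp: q_def algebra_simps)
      finally show ?thesis .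
    qed
    have "(\<lambda>n. \<integral>y. q (X (n + N)) y \<partial>lborel) \<longlonglongrightarrow> (\<integral>y. heat_kernel' t (x - y) * g y \<partial>lborel)"
    proof (rule integral_dominated_convergence[OF _ _ w])
      show "(\<lambda>y. heat_kernel' t (x - y) * g y) \<in> borel_measurable lborel"
        "(\<lambda>y. q (X (n + N)) y) \<in> borel_measurable lborel" for n
        unfolding q_def by measurable
      show "AE y in lborel. norm (q (X (n + N)) y) \<le> B * w y" for n
        using q_le[OF X0[of "n + N"]] N[of "n + N"] by (auto intro: less_imp_le)
      show "AE y in lborel. (\<lambda>n. q (X (n + N)) y) \<longlonglongrightarrow> heat_kernel' t (x - y) * g y"
      proof (rule AE_I2)
        fix y
        have "((\<lambda>h. (heat_kernel t (x - y + h) - heat_kernel t (x - y)) / h)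
            \<longlongrightarrow> heat_kernel' t (x - y)) (at 0)"
          using heat_kernel_has_real_derivative[OF t, of "x - y"] by (simp add: DERIV_def)
        then have "(\<lambda>n. (heat_kernel t (x - y + X n) - heat_kernel t (x - y)) / X n)
            \<longlonglongrightarrow> heat_kernel' t (x - y)"
          using X0 X unfolding tendsto_at_iff_sequentially comp_def by auto
        then have "(\<lambda>n. (heat_kernel t (x - y + X (n + N)) - heat_kernel t (x - y)) / X (n + N))
            \<longlonglongrightarrow> heat_kernel' t (x - y)"
          by (rule LIMSEQ_ignore_initial_segment)
        from tendsto_mult_right[OF this, of "g y"]
        show "(\<lambda>n. q (X (n + N)) y) \<longlonglongrightarrow> heat_kernel' t (x - y) * g y"
          by (simp add: q_def algebra_simps)
      qed
    qed
    from LIMSEQ_offset[OF this]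
    show "(\<lambda>n. (heat_sg t g (x + X n) - heat_sg t g x) / X n)
        \<longlonglongrightarrow> (\<integral>y. heat_kernel' t (x - y) * g y \<partial>lborel)"
      by (simp add: eq)
  qed
  \<comment> \<open>The limit was taken in the variable \<open>y\<close>; reflection returns to the
    convolution form.\<close>
  then show ?thesis
    using integral_reflect[of "\<lambda>z. heat_kernel' t z * g (x - z)" x] by (simp add: DERIV_def)
qed

section \<open>Estimates for the heat semigroup\<close>

lemma integrable_convolution:
  fixes k g :: "real \<Rightarrow> real"
  assumes "integrable lborel k" "g \<in> borel_measurable borel" "\<And>y. \<bar>g y\<bar> \<le> B"
  shows "integrable lborel (\<lambda>z. k z * g (x - z))"
proof (rule integrable_mult_bounded[OF assms(1)])
  show "(\<lambda>z. g (x - z)) \<in> borel_measurable borel"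
    using assms(2) by measurable
qed (use assms(3) in auto)

text \<open>Young's inequality for an integrable kernel and a bounded function; \<open>K\<close> is
  the L1 norm of the kernel.\<close>

lemma convolution_le:
  fixes k g :: "real \<Rightarrow> real"
  assumes k: "has_bochner_integral lborel (\<lambda>z. \<bar>k z\<bar>) K" "integrable lborel k"
    and g: "g \<in> borel_measurable borel" "\<And>y. \<bar>g y\<bar> \<le> B"
  shows "\<bar>\<integral>z. k z * g (x - z) \<partial>lborel\<bar> \<le> B * K"
proof -
  have "\<bar>\<integral>z. k z * g (x - z) \<partial>lborel\<bar> \<le> (\<integral>z. \<bar>k z * g (x - z)\<bar> \<partial>lborel)"
    by (rule integral_abs_bound)
  also have "\<dots> \<le> (\<integral>z. B * \<bar>k z\<bar> \<partial>lborel)"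
  proof (rule integral_mono)
    show "integrable lborel (\<lambda>z. \<bar>k z * g (x - z)\<bar>)"
      by (intro integrable_abs integrable_convolution[OF k(2) g])
    show "\<bar>k z * g (x - z)\<bar> \<le> B * \<bar>k z\<bar>" for z
      using mult_left_mono[OF g(2)[of "x - z"], of "\<bar>k z\<bar>"] by (simp add: abs_mult mult.commute)
  qed (use k(2) in simp)
  also have "\<dots> = B * K"
    using k(1) by (simp add: has_bochner_integral_iff)
  finally show ?thesis .
qed

lemma heat_sg_le:
  assumes "0 < t" "g \<in> borel_measurable borel" "\<And>y. \<bar>g y\<bar> \<le> B"
  shows "\<bar>heat_sg t g x\<bar> \<le> B"
  using convolution_le[OF _ integrable_heat_kernel assms(2,3), of t 1 x]
    has_bochner_integral_heat_kernel[of t] assms(1)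
  by (simp add: heat_sg_convolution heat_kernel_nonneg)

lemma heat_sg_diff:
  assumes "0 < t" "f \<in> borel_measurable borel" "\<And>y. \<bar>f y\<bar> \<le> B"
    "g \<in> borel_measurable borel" "\<And>y. \<bar>g y\<bar> \<le> C"
  shows "heat_sg t (\<lambda>y. f y - g y) x = heat_sg t f x - heat_sg t g x"
  using integrable_convolution[OF integrable_heat_kernel[OF assms(1)] assms(2,3), of x]
    integrable_convolution[OF integrable_heat_kernel[OF assms(1)] assms(4,5), of x]
  by (simp add: heat_sg_convolution right_diff_distrib)

lemma heat_sg_translate: "heat_sg t g (x + h) = heat_sg t (\<lambda>y. g (y + h)) x"
  by (simp add: heat_sg_convolution algebra_simps)

lemma dx_heat_sg_eq:
  assumes "0 < t" "g \<in> borel_measurable borel" "\<And>y. \<bar>g y\<bar> \<le> B"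
  shows "dx_heat_sg t g x = (\<integral>z. heat_kernel' t z * g (x - z) \<partial>lborel)"
  unfolding dx_heat_sg_def by (intro DERIV_imp_deriv heat_sg_has_real_derivative[OF assms])

lemma dx_heat_sg_le:
  assumes "0 < t" "g \<in> borel_measurable borel" "\<And>y. \<bar>g y\<bar> \<le> B"
  shows "\<bar>dx_heat_sg t g x\<bar> \<le> B * (1 / (sqrt pi * sqrt t))"
  using convolution_le[OF has_bochner_integral_abs_heat_kernel'[OF assms(1)]
      integrable_heat_kernel'[OF assms(1)] assms(2,3), of x]
  by (simp add: dx_heat_sg_eq[OF assms])

lemma dx_heat_sg_diff:
  assumes "0 < t" "f \<in> borel_measurable borel" "\<And>y. \<bar>f y\<bar> \<le> B"
    "g \<in> borel_measurable borel" "\<And>y. \<bar>g y\<bar> \<le> C"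
  shows "dx_heat_sg t (\<lambda>y. f y - g y) x = dx_heat_sg t f x - dx_heat_sg t g x"
proof -
  have "\<bar>f y - g y\<bar> \<le> B + C" for y
    using assms(3,5)[of y] by linarith
  moreover have "(\<lambda>y. f y - g y) \<in> borel_measurable borel"
    using assms(2,4) by measurable
  ultimately show ?thesis
    using integrable_convolution[OF integrable_heat_kernel'[OF assms(1)] assms(2,3), of x]
      integrable_convolution[OF integrable_heat_kernel'[OF assms(1)] assms(4,5), of x]
    by (simp add: dx_heat_sg_eq[OF assms(1-3)] dx_heat_sg_eq[OF assms(1,4,5)]
        dx_heat_sg_eq[OF assms(1), where B = "B + C"] right_diff_distrib)
qed

lemma dx_heat_sg_translate:
  assumes "0 < t" "g \<in> borel_measurable borel" "\<And>y. \<bar>g y\<bar> \<le> B"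
  shows "dx_heat_sg t g (x + h) = dx_heat_sg t (\<lambda>y. g (y + h)) x"
proof -
  have "(\<lambda>y. g (y + h)) \<in> borel_measurable borel"
    using assms(2) by measurable
  then show ?thesis
    using assms(3) by (simp add: dx_heat_sg_eq[OF assms] dx_heat_sg_eq[OF assms(1), where B = B]
        algebra_simps)
qed

text \<open>The smoothing estimate combined with the mean value theorem. It serves data known only
  by their size, such as the difference between \<open>u0\<close> and the centred profile.\<close>

lemma heat_sg_increment_le:
  assumes "0 < t" "g \<in> borel_measurable borel" "\<And>y. \<bar>g y\<bar> \<le> B" "0 < h"
  shows "\<bar>heat_sg t g (x + h) - heat_sg t g x\<bar> \<le> h * (B * (1 / (sqrt pi * sqrt t)))"
proof -
  have D: "(heat_sg t g has_real_derivative dx_heat_sg t g x) (at x)" for x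
    unfolding dx_heat_sg_eq[OF assms(1-3)] by (rule heat_sg_has_real_derivative[OF assms(1-3)])
  obtain z where "heat_sg t g (x + h) - heat_sg t g x = h * dx_heat_sg t g z"
    using MVT2[of x "x + h", OF _ D] assms(4) by auto
  then show ?thesis
    using mult_left_mono[OF dx_heat_sg_le[OF assms(1-3), of z], of h] assms(4)
    by (simp add: abs_mult)
qed

text \<open>The flow commutes with translations and contracts the sup norm, so increments at step
  \<open>h\<close> are inherited without loss.\<close>

lemma heat_sg_increment_le_modulus:
  assumes t: "0 < t" and g [measurable]: "g \<in> borel_measurable borel" and B: "\<And>y. \<bar>g y\<bar> \<le> B"
    and L: "\<And>y. \<bar>g (y + h) - g y\<bar> \<le> L"
  shows "\<bar>heat_sg t g (x + h) - heat_sg t g x\<bar> \<le> L"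
proof -
  have "heat_sg t g (x + h) - heat_sg t g x = heat_sg t (\<lambda>y. g (y + h) - g y) x"
    using B by (subst heat_sg_diff[OF t, where B = B and C = B]) (auto simp: heat_sg_translate)
  then show ?thesis
    using heat_sg_le[OF t _ L] by simp
qed

text \<open>The limit of the inherited increments as \<open>h\<close> decreases to 0. Unlike
  \<open>dx_heat_sg_le\<close>, this bound does not blow up as \<open>t\<close> tends to 0.\<close>

lemma dx_heat_sg_le_lipschitz:
  assumes "0 < t" "g \<in> borel_measurable borel" "\<And>y. \<bar>g y\<bar> \<le> B"
    and L: "\<And>y h. 0 < h \<Longrightarrow> \<bar>g (y + h) - g y\<bar> \<le> L * h"
  shows "\<bar>dx_heat_sg t g x\<bar> \<le> L"
proof (rule tendsto_upperbound)
  have "((\<lambda>h. (heat_sg t g (x + h) - heat_sg t g x) / h) \<longlongrightarrow> dx_heat_sg t g x) (at 0)"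
    using heat_sg_has_real_derivative[OF assms(1-3), of x]
    unfolding dx_heat_sg_eq[OF assms(1-3)] DERIV_def .
  then show "((\<lambda>h. \<bar>(heat_sg t g (x + h) - heat_sg t g x) / h\<bar>) \<longlongrightarrow> \<bar>dx_heat_sg t g x\<bar>) (at_right 0)"
    by (intro tendsto_rabs) (simp add: filterlim_at_split)
  show "\<forall>\<^sub>F h in at_right 0. \<bar>(heat_sg t g (x + h) - heat_sg t g x) / h\<bar> \<le> L"
    using eventually_at_right_less
  proof eventually_elim
    case (elim h)
    then show ?case
      using heat_sg_increment_le_modulus[OF assms(1-3) L, of h x] by (simp add: field_simps)
  qed
qed simp

section \<open>Time integrals with endpoint singularities\<close>

text \<open>Allows \<open>f\<close> to be singular at both endpoints: nonnegativity and a primitive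
  continuous up to the boundary already force integrability.\<close>

lemma set_integral_FTC_nonneg:
  fixes f F :: "real \<Rightarrow> real"
  assumes "0 < t" "continuous_on {0..t} F"
    and "\<And>s. 0 < s \<Longrightarrow> s < t \<Longrightarrow> DERIV F s :> f s"
    and "\<And>s. 0 < s \<Longrightarrow> s < t \<Longrightarrow> isCont f s"
    and "\<And>s. 0 < s \<Longrightarrow> s < t \<Longrightarrow> 0 \<le> f s"
  shows "set_integrable lborel {0<..<t} f" "(LINT s:{0<..<t}|lborel. f s) = F t - F 0"
proof -
  have lim: "((F \<circ> real_of_ereal) \<longlongrightarrow> F 0) (at_right (ereal 0))"
    "((F \<circ> real_of_ereal) \<longlongrightarrow> F t) (at_left (ereal t))"
    using assms(1,2) unfolding ereal_tendsto_simps
    by (auto dest: continuous_on_Icc_at_rightD continuous_on_Icc_at_leftD)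
  have ein: "einterval (ereal 0) (ereal t) = {0<..<t}"
    by (auto simp: einterval_iff)
  have "set_integrable lborel (einterval (ereal 0) (ereal t)) f"
    by (rule interval_integral_FTC_nonneg(1)[OF _ _ _ _ lim]) (use assms in auto)
  then show "set_integrable lborel {0<..<t} f"
    unfolding ein .
  have "(LBINT s=ereal 0..ereal t. f s) = F t - F 0"
    by (rule interval_integral_FTC_nonneg(2)[OF _ _ _ _ lim]) (use assms in auto)
  then show "(LINT s:{0<..<t}|lborel. f s) = F t - F 0"
    using assms(1) by (simp add: interval_lebesgue_integral_def ein del: zero_ereal_def)
qed

lemma integral_inverse_sqrt:
  assumes "0 < t"
  shows "set_integrable lborel {0<..<t} (\<lambda>s. 1 / sqrt s)"
    "(LINT s:{0<..<t}|lborel. 1 / sqrt s) = 2 * sqrt t"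
proof -
  have "DERIV (\<lambda>s. 2 * sqrt s) s :> 1 / sqrt s" if "0 < s" for s
    using that by (auto intro!: derivative_eq_intros simp: field_simps)
  moreover have "isCont (\<lambda>s. 1 / sqrt s) s" if "0 < s" for s
    using that by (intro continuous_intros) auto
  moreover have "continuous_on {0..t} (\<lambda>s. 2 * sqrt s)"
    by (intro continuous_intros)
  ultimately show "set_integrable lborel {0<..<t} (\<lambda>s. 1 / sqrt s)"
    "(LINT s:{0<..<t}|lborel. 1 / sqrt s) = 2 * sqrt t"
    using set_integral_FTC_nonneg[OF assms, of "\<lambda>s. 2 * sqrt s" "\<lambda>s. 1 / sqrt s"] by auto
qed

lemma integral_inverse_sqrt_reflected:
  assumes "0 < t"
  shows "set_integrable lborel {0<..<t} (\<lambda>s. 1 / sqrt (t - s))"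
    "(LINT s:{0<..<t}|lborel. 1 / sqrt (t - s)) = 2 * sqrt t"
proof -
  have "DERIV (\<lambda>s. - 2 * sqrt (t - s)) s :> 1 / sqrt (t - s)" if "s < t" for s
    using that by (auto intro!: derivative_eq_intros simp: field_simps)
  moreover have "isCont (\<lambda>s. 1 / sqrt (t - s)) s" if "s < t" for s
    using that by (intro continuous_intros) auto
  moreover have "continuous_on {0..t} (\<lambda>s. - 2 * sqrt (t - s))"
    by (intro continuous_intros)
  ultimately show "set_integrable lborel {0<..<t} (\<lambda>s. 1 / sqrt (t - s))"
    "(LINT s:{0<..<t}|lborel. 1 / sqrt (t - s)) = 2 * sqrt t"
    using set_integral_FTC_nonneg[OF assms, of "\<lambda>s. - 2 * sqrt (t - s)" "\<lambda>s. 1 / sqrt (t - s)"]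
    by auto
qed

text \<open>The Beta integral B(1/2, 1/2). The primitive \<open>arcsin (2 * s / t - 1)\<close> runs
  from -pi/2 to pi/2, so the value is independent of \<open>t\<close>.\<close>

lemma integral_inverse_sqrt_product:
  assumes "0 < t"
  shows "set_integrable lborel {0<..<t} (\<lambda>s. 1 / (sqrt s * sqrt (t - s)))"
    "(LINT s:{0<..<t}|lborel. 1 / (sqrt s * sqrt (t - s))) = pi"
proof -
  have "DERIV (\<lambda>s. arcsin (2 * s / t - 1)) s :> 1 / (sqrt s * sqrt (t - s))"
    if "0 < s" "s < t" for s
  proof -
    have "1 - (2 * s / t - 1)\<^sup>2 = (2 / t)\<^sup>2 * (s * (t - s))"
      using assms by (simp add: field_simps power2_eq_square)
    then have "sqrt (1 - (2 * s / t - 1)\<^sup>2) = 2 / t * (sqrt s * sqrt (t - s))"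
      using assms that by (simp add: real_sqrt_mult)
    moreover have "DERIV (\<lambda>s. arcsin (2 * s / t - 1)) s
        :> inverse (sqrt (1 - (2 * s / t - 1)\<^sup>2)) * (2 / t)"
      using assms that
      by (intro DERIV_chain2[OF DERIV_arcsin]) (auto intro!: derivative_eq_intros simp: field_simps)
    ultimately show ?thesis
      using assms that by (simp add: field_simps)
  qed
  moreover have "isCont (\<lambda>s. 1 / (sqrt s * sqrt (t - s))) s" if "0 < s" "s < t" for s
    using that by (intro continuous_intros) auto
  moreover have "continuous_on {0..t} (\<lambda>s. arcsin (2 * s / t - 1))"
    using assms by (intro continuous_intros) (auto simp: field_simps)
  ultimately show "set_integrable lborel {0<..<t} (\<lambda>s. 1 / (sqrt s * sqrt (t - s)))"
    "(LINT s:{0<..<t}|lborel. 1 / (sqrt s * sqrt (t - s))) = pi"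
    using set_integral_FTC_nonneg[OF assms, of "\<lambda>s. arcsin (2 * s / t - 1)"
        "\<lambda>s. 1 / (sqrt s * sqrt (t - s))"] assms
    by auto
qed

lemma set_integral_abs_le:
  fixes f g :: "real \<Rightarrow> real"
  assumes "set_integrable M A f" "set_integrable M A g" "\<And>s. s \<in> A \<Longrightarrow> \<bar>f s\<bar> \<le> g s"
  shows "\<bar>LINT s:A|M. f s\<bar> \<le> (LINT s:A|M. g s)"
proof -
  have "\<bar>LINT s:A|M. f s\<bar> \<le> (LINT s:A|M. \<bar>f s\<bar>)"
    using set_integral_norm_bound[OF assms(1)] by simp
  also have "\<dots> \<le> (LINT s:A|M. g s)"
    by (intro set_integral_mono set_integrable_abs assms)
  finally show ?thesis .
qed

text \<open>Dropping the endpoints keeps the semigroup time \<open>t - s\<close> positive and avoids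
  the singularity of the weights at \<open>s = 0\<close>.\<close>

lemma set_integral_Icc_eq_Ioo:
  fixes f :: "real \<Rightarrow> real"
  shows "(LINT s:{a..b}|lborel. f s) = (LINT s:{a<..<b}|lborel. f s)"
  by (rule set_integral_discrete_difference[where X = "{a, b}"]) auto

text \<open>The smoothing estimate dominates the integrand by a multiple of
  \<open>1 / sqrt (t - s)\<close>.\<close>

lemma set_integrable_duhamel:
  assumes t: "0 < t" and f [measurable]: "case_prod f \<in> borel_measurable (borel \<Otimes>\<^sub>M borel)"
    and B: "\<And>s y. 0 < s \<Longrightarrow> s < t \<Longrightarrow> \<bar>f s y\<bar> \<le> B"
  shows "set_integrable lborel {0<..<t} (\<lambda>s. dx_heat_sg (t - s) (f s) x)"
proof -
  have f_slice: "f s \<in> borel_measurable borel" for s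
    using f by measurable
  have "set_integrable lborel {0<..<t} (\<lambda>s. B * (1 / sqrt pi) * (1 / sqrt (t - s)))"
    using integral_inverse_sqrt_reflected(1)[OF t] by (rule set_integrable_mult_right)
  moreover have "set_borel_measurable lborel {0<..<t} (\<lambda>s. dx_heat_sg (t - s) (f s) x)"
  proof -
    \<comment> \<open>Measurability in \<open>s\<close> is clear for an integral depending on a
      parameter, not for \<open>deriv\<close>; the two expressions agree on the open
      interval.\<close>
    have "(\<lambda>s. indicator {0<..<t} s *\<^sub>R (\<integral>z. heat_kernel' (t - s) z * f s (x - z) \<partial>lborel))
        \<in> borel_measurable lborel"
      by measurable
    moreover have "indicator {0<..<t} s *\<^sub>R dx_heat_sg (t - s) (f s) x =
        indicator {0<..<t} s *\<^sub>R (\<integral>z. heat_kernel' (t - s) z * f s (x - z) \<partial>lborel)" for s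
      using B f_slice by (auto simp: indicator_def intro!: dx_heat_sg_eq)
    ultimately show ?thesis
      unfolding set_borel_measurable_def by presburger
  qed
  ultimately show ?thesis
  proof (rule set_integrable_bound)
    show "AE s in lborel. s \<in> {0<..<t} \<longrightarrow>
        norm (dx_heat_sg (t - s) (f s) x) \<le> norm (B * (1 / sqrt pi) * (1 / sqrt (t - s)))"
    proof (intro AE_I2 impI)
      fix s assume s: "s \<in> {0<..<t}"
      then have "\<bar>dx_heat_sg (t - s) (f s) x\<bar> \<le> B * (1 / (sqrt pi * sqrt (t - s)))"
        using B f_slice by (intro dx_heat_sg_le) auto
      moreover have "0 \<le> B" using B[of s 0] s by fastforce
      ultimately show "norm (dx_heat_sg (t - s) (f s) x) \<le> norm (B * (1 / sqrt pi) * (1 / sqrt (t - s)))"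
        using s by (simp add: abs_mult)
    qed
  qed
qed

section \<open>The profile\<close>

text \<open>Both branches have slope \<open>- a\<close> at the origin, so they glue to a
  differentiable function with a single formula for the slope.\<close>

lemma phi_prof_has_real_derivative:
  "(phi_prof a has_real_derivative - a * exp (- \<bar>x\<bar>)) (at x)"
proof -
  define f g where "f = (\<lambda>x::real. a * (exp (- x) - 1))" and "g = (\<lambda>x::real. - (a * (exp x - 1)))"
  have f: "(f has_real_derivative - a * exp (- x)) (at x)" for x
    unfolding f_def by (auto intro!: derivative_eq_intros)
  have g: "(g has_real_derivative - a * exp x) (at x)" for x
    unfolding g_def by (auto intro!: derivative_eq_intros)
  consider "x > 0" | "x < 0" | "x = 0" by linarith
  then show ?thesis
  proof cases
    case 1
    have "(phi_prof a has_real_derivative - a * exp (- x)) (at x)"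
      by (rule DERIV_cong_ev[THEN iffD1, OF refl _ refl f])
        (use eventually_nhds_in_open[of "{0<..}" x] 1 in
          \<open>auto simp: f_def phi_prof_def elim!: eventually_mono\<close>)
    then show ?thesis using 1 by simp
  next
    case 2
    have "(phi_prof a has_real_derivative - a * exp x) (at x)"
      by (rule DERIV_cong_ev[THEN iffD1, OF refl _ refl g])
        (use eventually_nhds_in_open[of "{..<0}" x] 2 in
          \<open>auto simp: g_def phi_prof_def elim!: eventually_mono\<close>)
    then show ?thesis using 2 by simp
  next
    case 3
    \<comment> \<open>Each one-sided quotient coincides with that of the smooth branch
      \<open>g\<close> or \<open>f\<close>.\<close>
    have "((\<lambda>y. (phi_prof a y - phi_prof a 0) / (y - 0)) \<longlongrightarrow> - a) (at 0)"
    proof (rule filterlim_split_at)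
      have "((\<lambda>y. (g y - g 0) / (y - 0)) \<longlongrightarrow> - a) (at_left 0)"
        using g[of 0] unfolding has_field_derivative_iff filterlim_at_split by simp
      then show "((\<lambda>y. (phi_prof a y - phi_prof a 0) / (y - 0)) \<longlongrightarrow> - a) (at_left 0)"
        by (rule Lim_transform_eventually)
          (auto simp: eventually_at_filter g_def phi_prof_def)
      have "((\<lambda>y. (f y - f 0) / (y - 0)) \<longlongrightarrow> - a) (at_right 0)"
        using f[of 0] unfolding has_field_derivative_iff filterlim_at_split by simp
      then show "((\<lambda>y. (phi_prof a y - phi_prof a 0) / (y - 0)) \<longlongrightarrow> - a) (at_right 0)"
        by (rule Lim_transform_eventually)
          (auto simp: eventually_at_filter f_def phi_prof_def)
    qed
    then show ?thesis using 3 by (simp add: has_field_derivative_iff)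
  qed
qed

lemma phi_prof_measurable [measurable]: "phi_prof a \<in> borel_measurable borel"
  by (intro borel_measurable_continuous_onI)
    (auto intro!: continuous_at_imp_continuous_on DERIV_isCont[OF phi_prof_has_real_derivative])

lemma phi_prof_zero: "phi_prof a 0 = 0"
  by (simp add: phi_prof_def)

lemma phi_prof_odd: "phi_prof a (- x) = - phi_prof a x"
  by (simp add: phi_prof_def)

lemma abs_phi_prof:
  assumes "0 \<le> a"
  shows "\<bar>phi_prof a x\<bar> = a * (1 - exp (- \<bar>x\<bar>))"
proof (cases "x \<ge> 0")
  case True
  then have "a * (exp (- x) - 1) \<le> 0"
    using assms by (intro mult_nonneg_nonpos) auto
  with True show ?thesis by (simp add: phi_prof_def algebra_simps)
next
  case False
  then have "a * (exp x - 1) \<le> 0"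
    using assms by (intro mult_nonneg_nonpos) auto
  with False show ?thesis by (simp add: phi_prof_def algebra_simps)
qed

lemma abs_phi_prof_le:
  assumes "0 \<le> a"
  shows "\<bar>phi_prof a x\<bar> \<le> a"
  using assms by (simp add: abs_phi_prof algebra_simps)

lemma phi_prof_diff:
  assumes "x < y"
  obtains z where "x < z" "z < y" "phi_prof a x - phi_prof a y = (y - x) * (a * exp (- \<bar>z\<bar>))"
proof -
  obtain z where "x < z" "z < y" "phi_prof a y - phi_prof a x = (y - x) * (- a * exp (- \<bar>z\<bar>))"
    using MVT2[OF assms phi_prof_has_real_derivative] by blast
  then show ?thesis by (intro that[of z]) (auto simp: algebra_simps)
qed

lemma phi_prof_diff_le:
  assumes "0 \<le> a" "x \<le> y"
  shows "0 \<le> phi_prof a x - phi_prof a y" "phi_prof a x - phi_prof a y \<le> a * (y - x)"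
proof -
  have "0 \<le> phi_prof a x - phi_prof a y \<and> phi_prof a x - phi_prof a y \<le> a * (y - x)"
  proof (cases "x < y")
    case True
    then obtain z where z: "phi_prof a x - phi_prof a y = (y - x) * (a * exp (- \<bar>z\<bar>))"
      using phi_prof_diff by blast
    have "a * exp (- \<bar>z\<bar>) \<le> a"
      using mult_left_mono[of "exp (- \<bar>z\<bar>)" 1 a] assms by simp
    then have "(y - x) * (a * exp (- \<bar>z\<bar>)) \<le> (y - x) * a"
      using True by (intro mult_left_mono) auto
    then show ?thesis
      using z assms by (simp add: mult.commute)
  qed (use assms in auto)
  then show "0 \<le> phi_prof a x - phi_prof a y" "phi_prof a x - phi_prof a y \<le> a * (y - x)"
    by auto
qed

text \<open>By the triangle inequality the steepness at \<open>w - z\<close> is at least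
  \<open>exp (- \<bar>z\<bar>)\<close> times the steepness at \<open>w\<close>; hence
  \<open>F\<close> is nonincreasing.\<close>

lemma phi_prof_translate_diff:
  assumes "0 \<le> a" "x \<le> y"
  shows "exp (- \<bar>z\<bar>) * (phi_prof a x - phi_prof a y) \<le> phi_prof a (x - z) - phi_prof a (y - z)"
proof -
  define F where "F = (\<lambda>w. phi_prof a (w - z) - exp (- \<bar>z\<bar>) * phi_prof a w)"
  have F: "(F has_real_derivative - a * exp (- \<bar>w - z\<bar>) - exp (- \<bar>z\<bar>) * (- a * exp (- \<bar>w\<bar>))) (at w)"
    for w
    unfolding F_def
    by (intro DERIV_diff DERIV_cmult phi_prof_has_real_derivative
        DERIV_shift[THEN iffD1, of _ _ w "- z", simplified])
  have "- a * exp (- \<bar>w - z\<bar>) - exp (- \<bar>z\<bar>) * (- a * exp (- \<bar>w\<bar>)) \<le> 0" for w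
  proof -
    have "exp (- \<bar>z\<bar>) * exp (- \<bar>w\<bar>) \<le> exp (- \<bar>w - z\<bar>)"
      unfolding exp_add[symmetric] by simp
    from mult_left_mono[OF this assms(1)] show ?thesis
      by (simp add: algebra_simps)
  qed
  then have "F y \<le> F x"
    using DERIV_nonpos_imp_nonincreasing[OF assms(2), of F] F by blast
  then show ?thesis
    by (simp add: F_def algebra_simps)
qed

section \<open>Heat flow of the profile\<close>

text \<open>Average \<open>phi_prof_translate_diff\<close> against the kernel, with
  \<open>exp (- \<bar>z\<bar>)\<close> bounded below by \<open>1 - \<bar>z\<bar>\<close>; the lost
  fraction is the first absolute moment of the kernel.\<close>

lemma heat_sg_phi_prof_diff:
  assumes t: "0 < t" and a: "0 \<le> a" and "x \<le> y"
  shows "(1 - 2 * sqrt t / sqrt pi) * (phi_prof a x - phi_prof a y)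
    \<le> heat_sg t (phi_prof a) x - heat_sg t (phi_prof a) y"
proof -
  note int = integrable_convolution[OF integrable_heat_kernel[OF t] phi_prof_measurable
      abs_phi_prof_le[OF a]]
  note k = has_bochner_integral_heat_kernel[OF t] has_bochner_integral_abs_heat_kernel[OF t]
  let ?d = "phi_prof a x - phi_prof a y"
  have "has_bochner_integral lborel (\<lambda>z. (heat_kernel t z - \<bar>z\<bar> * heat_kernel t z) * ?d)
      ((1 - 2 * sqrt t / sqrt pi) * ?d)"
    by (intro has_bochner_integral_mult_left has_bochner_integral_diff k)
  then have int': "integrable lborel (\<lambda>z. (heat_kernel t z - \<bar>z\<bar> * heat_kernel t z) * ?d)"
    and "(1 - 2 * sqrt t / sqrt pi) * ?d =
      (\<integral>z. (heat_kernel t z - \<bar>z\<bar> * heat_kernel t z) * ?d \<partial>lborel)"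
    by (auto simp: has_bochner_integral_iff)
  note this(2)
  also have "\<dots> \<le> (\<integral>z. heat_kernel t z * phi_prof a (x - z) - heat_kernel t z * phi_prof a (y - z) \<partial>lborel)"
  proof (rule integral_mono[OF int'])
    fix z
    have "(1 - \<bar>z\<bar>) * ?d \<le> exp (- \<bar>z\<bar>) * ?d"
      using phi_prof_diff_le(1)[OF a \<open>x \<le> y\<close>] exp_ge_add_one_self[of "- \<bar>z\<bar>"]
      by (intro mult_right_mono) auto
    also have "\<dots> \<le> phi_prof a (x - z) - phi_prof a (y - z)"
      by (rule phi_prof_translate_diff[OF a \<open>x \<le> y\<close>])
    finally show "(heat_kernel t z - \<bar>z\<bar> * heat_kernel t z) * ?d
        \<le> heat_kernel t z * phi_prof a (x - z) - heat_kernel t z * phi_prof a (y - z)"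
      using mult_left_mono[OF _ heat_kernel_nonneg, of _ _ t z] by (fastforce simp: algebra_simps)
  qed (use int in auto)
  also have "\<dots> = heat_sg t (phi_prof a) x - heat_sg t (phi_prof a) y"
    using int by (simp add: heat_sg_convolution)
  finally show ?thesis .
qed

text \<open>The kernel is even and the profile odd.\<close>

lemma heat_sg_phi_prof_zero: "heat_sg t (phi_prof a) 0 = 0"
proof -
  have "heat_sg t (phi_prof a) 0 = (\<integral>z. heat_kernel t z * phi_prof a z \<partial>lborel)"
    using integral_reflect[of "\<lambda>z. heat_kernel t z * phi_prof a (- z)" 0]
    by (simp add: heat_sg_convolution heat_kernel_def)
  also have "\<dots> = - heat_sg t (phi_prof a) 0"
    by (simp add: heat_sg_convolution phi_prof_odd)
  finally show ?thesis by simp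
qed

text \<open>Compares \<open>x\<close> with the origin, a common zero of the profile and its flow.
  This later confines the zeros of the solution to a neighbourhood of the centre.\<close>

lemma abs_heat_sg_phi_prof_ge:
  assumes "0 < t" "0 \<le> a"
  shows "(1 - 2 * sqrt t / sqrt pi) * \<bar>phi_prof a x\<bar> \<le> \<bar>heat_sg t (phi_prof a) x\<bar>"
proof (cases "x \<ge> 0")
  case True
  with phi_prof_diff_le(1)[OF assms(2), of 0 x] heat_sg_phi_prof_diff[OF assms, of 0 x]
  show ?thesis by (auto simp: phi_prof_zero heat_sg_phi_prof_zero)
next
  case False
  with phi_prof_diff_le(1)[OF assms(2), of x 0] heat_sg_phi_prof_diff[OF assms, of x 0]
  show ?thesis by (auto simp: phi_prof_zero heat_sg_phi_prof_zero)
qed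

section \<open>Mild solutions\<close>

lemma Cub_measurable: "Cub g \<Longrightarrow> g \<in> borel_measurable borel"
  unfolding Cub_def
  by (auto intro: borel_measurable_continuous_onI uniformly_continuous_imp_continuous)

lemma Cub_bounded:
  assumes "Cub g"
  obtains B where "\<And>y. \<bar>g y\<bar> \<le> B"
  using assms unfolding Cub_def bounded_iff by auto

lemma mild_solution_duhamel:
  assumes "mild_solution u0 u" "0 < t"
  shows "u t x = heat_sg t u0 x
    + (LINT s:{0<..<t}|lborel. dx_heat_sg (t - s) (\<lambda>y. \<bar>u s y\<bar>) x)"
  using assms unfolding mild_solution_def set_integral_Icc_eq_Ioo by blast

text \<open>Continuity in time with values in the sup norm gives local bounds; bisection makes them
  uniform on the compact time interval.\<close>

lemma mild_solution_bounded:
  assumes u: "mild_solution u0 u" and "0 \<le> T"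
  obtains B where "\<And>s y. 0 \<le> s \<Longrightarrow> s \<le> T \<Longrightarrow> \<bar>u s y\<bar> \<le> B"
proof -
  \<comment> \<open>The doubled condition matches the predicate of the bisection, whose local step
    also meets intervals reaching below 0.\<close>
  have "\<exists>B. \<forall>s y. 0 \<le> s \<and> 0 \<le> s \<and> s \<le> T \<longrightarrow> \<bar>u s y\<bar> \<le> B"
    using \<open>0 \<le> T\<close>
  proof (induction rule: Bolzano[where P = "\<lambda>a b. \<exists>B. \<forall>s y. 0 \<le> s \<and> a \<le> s \<and> s \<le> b \<longrightarrow> \<bar>u s y\<bar> \<le> B"])
    case (trans a b c)
    then obtain B C where "\<forall>s y. 0 \<le> s \<and> a \<le> s \<and> s \<le> b \<longrightarrow> \<bar>u s y\<bar> \<le> B"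
      "\<forall>s y. 0 \<le> s \<and> b \<le> s \<and> s \<le> c \<longrightarrow> \<bar>u s y\<bar> \<le> C"
      by blast
    then have "\<forall>s y. 0 \<le> s \<and> a \<le> s \<and> s \<le> c \<longrightarrow> \<bar>u s y\<bar> \<le> max B C"
      by (meson le_max_iff_disj linear)
    then show ?case by blast
  next
    case (local x)
    obtain B where B: "\<And>y. \<bar>u x y\<bar> \<le> B"
      using u local(1) unfolding mild_solution_def by (metis Cub_bounded)
    obtain d where d: "d > 0" "\<forall>s\<ge>0. \<bar>s - x\<bar> < d \<longrightarrow> (\<forall>y. \<bar>u s y - u x y\<bar> \<le> 1)"
      using u local(1) unfolding mild_solution_def by (meson zero_less_one)
    have "\<bar>u s y\<bar> \<le> B + 1" if "0 \<le> s" "\<bar>s - x\<bar> < d" for s y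
    proof -
      have "\<bar>u s y - u x y\<bar> \<le> 1" using d(2) that by blast
      then show ?thesis using B[of y] by linarith
    qed
    then have "\<forall>s y. 0 \<le> s \<and> a \<le> s \<and> s \<le> b \<longrightarrow> \<bar>u s y\<bar> \<le> B + 1"
      if "a \<le> x" "x \<le> b" "b - a < d" for a b
      using that by force
    then show ?case using d(1) by meson
  qed
  then show ?thesis using that by blast
qed

text \<open>Nothing is known about \<open>u\<close> at negative times; clamping the time at 0 makes
  it jointly continuous on the whole plane.\<close>

lemma mild_solution_measurable:
  assumes "mild_solution u0 u"
  shows "(\<lambda>(s, y). u (max 0 s) y) \<in> borel_measurable (borel \<Otimes>\<^sub>M borel)"
proof -
  have "continuous_on UNIV (\<lambda>p :: real \<times> real. u (max 0 (fst p)) (snd p))"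
  proof (clarsimp simp: continuous_on_iff)
    fix s y e :: real assume "0 < e"
    have "\<exists>d>0. \<forall>r\<ge>0. \<bar>r - max 0 s\<bar> < d \<longrightarrow> (\<forall>x. \<bar>u r x - u (max 0 s) x\<bar> \<le> e / 2)"
      using assms \<open>0 < e\<close> unfolding mild_solution_def by (meson half_gt_zero max.cobounded1)
    then obtain d where d: "d > 0"
      "\<And>r x. r \<ge> 0 \<Longrightarrow> \<bar>r - max 0 s\<bar> < d \<Longrightarrow> \<bar>u r x - u (max 0 s) x\<bar> \<le> e / 2"
      by blast
    have "continuous_on UNIV (u (max 0 s))"
      using assms unfolding mild_solution_def Cub_def
      by (auto intro: uniformly_continuous_imp_continuous)
    then obtain d' where d': "d' > 0"
      "\<And>x. \<bar>x - y\<bar> < d' \<Longrightarrow> \<bar>u (max 0 s) x - u (max 0 s) y\<bar> < e / 2"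
      using \<open>0 < e\<close> unfolding continuous_on_iff dist_real_def by (meson UNIV_I half_gt_zero)
    show "\<exists>\<delta>>0. \<forall>r x. dist (r, x) (s, y) < \<delta> \<longrightarrow> dist (u (max 0 r) x) (u (max 0 s) y) < e"
    proof (intro exI[of _ "min d d'"] conjI allI impI)
      fix r x assume *: "dist (r, x) (s, y) < min d d'"
      have "\<bar>r - s\<bar> < d" "\<bar>x - y\<bar> < d'"
        using * dist_fst_le[of "(r, x)" "(s, y)"] dist_snd_le[of "(r, x)" "(s, y)"]
        by (auto simp: dist_real_def)
      moreover have "\<bar>max 0 r - max 0 s\<bar> \<le> \<bar>r - s\<bar>" by linarith
      ultimately have "\<bar>u (max 0 r) x - u (max 0 s) x\<bar> \<le> e / 2"
        "\<bar>u (max 0 s) x - u (max 0 s) y\<bar> < e / 2"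
        using d d' by auto
      then show "dist (u (max 0 r) x) (u (max 0 s) y) < e"
        unfolding dist_real_def by linarith
    qed (use d d' in auto)
  qed
  then show ?thesis
    unfolding borel_prod case_prod_beta' by (rule borel_measurable_continuous_onI)
qed

text \<open>The defining conditions see nonnegative times only, so the clamped function may replace
  \<open>u\<close> wherever joint measurability is wanted.\<close>

lemma mild_solution_extend:
  assumes "mild_solution u0 u"
  shows "mild_solution u0 (\<lambda>s. u (max 0 s))"
proof -
  have "(LINT s:{0..t}|lborel. dx_heat_sg (t - s) (\<lambda>y. \<bar>u (max 0 s) y\<bar>) x)
      = (LINT s:{0..t}|lborel. dx_heat_sg (t - s) (\<lambda>y. \<bar>u s y\<bar>) x)" for t x
    by (rule set_lebesgue_integral_cong) auto
  then show ?thesis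
    using assms by (simp add: mild_solution_def)
qed

section \<open>Increment bounds for the Duhamel term and the solution\<close>

text \<open>The reverse triangle inequality bounds increments of the absolute value by those of
  \<open>u\<close>, which is what closes the inequality in spite of the nonsmooth
  nonlinearity.\<close>

lemma duhamel_increment_le:
  assumes t: "0 < t" and u [measurable]: "case_prod u \<in> borel_measurable (borel \<Otimes>\<^sub>M borel)"
    and B: "\<And>s y. 0 < s \<Longrightarrow> s < t \<Longrightarrow> \<bar>u s y\<bar> \<le> B"
    and G: "\<And>s y. 0 < s \<Longrightarrow> s < t \<Longrightarrow> \<bar>u s (y + h) - u s y\<bar> \<le> G s"
    and G_int: "set_integrable lborel {0<..<t} (\<lambda>s. G s * (1 / (sqrt pi * sqrt (t - s))))"
  shows "\<bar>(LINT s:{0<..<t}|lborel. dx_heat_sg (t - s) (\<lambda>y. \<bar>u s y\<bar>) (x + h))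
      - (LINT s:{0<..<t}|lborel. dx_heat_sg (t - s) (\<lambda>y. \<bar>u s y\<bar>) x)\<bar>
    \<le> (LINT s:{0<..<t}|lborel. G s * (1 / (sqrt pi * sqrt (t - s))))"
proof -
  have slice: "(\<lambda>y. \<bar>u s y\<bar>) \<in> borel_measurable borel" for s
    by measurable
  have slice': "(\<lambda>y. \<bar>u s (y + h)\<bar>) \<in> borel_measurable borel" for s
    by measurable
  have int: "set_integrable lborel {0<..<t} (\<lambda>s. dx_heat_sg (t - s) (\<lambda>y. \<bar>u s y\<bar>) x)" for x
    using B by (intro set_integrable_duhamel[OF t]) auto
  have "(LINT s:{0<..<t}|lborel. dx_heat_sg (t - s) (\<lambda>y. \<bar>u s y\<bar>) (x + h))
      - (LINT s:{0<..<t}|lborel. dx_heat_sg (t - s) (\<lambda>y. \<bar>u s y\<bar>) x)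
    = (LINT s:{0<..<t}|lborel. dx_heat_sg (t - s) (\<lambda>y. \<bar>u s y\<bar>) (x + h)
        - dx_heat_sg (t - s) (\<lambda>y. \<bar>u s y\<bar>) x)"
    by (rule set_integral_diff(2)[OF int int, symmetric])
  also have "\<bar>\<dots>\<bar> \<le> (LINT s:{0<..<t}|lborel. G s * (1 / (sqrt pi * sqrt (t - s))))"
  proof (rule set_integral_abs_le[OF set_integral_diff(1)[OF int int] G_int])
    fix s assume s: "s \<in> {0<..<t}"
    have "dx_heat_sg (t - s) (\<lambda>y. \<bar>u s y\<bar>) (x + h) - dx_heat_sg (t - s) (\<lambda>y. \<bar>u s y\<bar>) x
        = dx_heat_sg (t - s) (\<lambda>y. \<bar>u s (y + h)\<bar> - \<bar>u s y\<bar>) x"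
      using s B slice slice'
      by (subst dx_heat_sg_diff[where B = B and C = B])
        (auto simp: dx_heat_sg_translate[where B = B])
    also have "\<bar>\<dots>\<bar> \<le> G s * (1 / (sqrt pi * sqrt (t - s)))"
    proof (rule dx_heat_sg_le)
      show "(\<lambda>y. \<bar>u s (y + h)\<bar> - \<bar>u s y\<bar>) \<in> borel_measurable borel"
        by measurable
      show "\<bar>\<bar>u s (y + h)\<bar> - \<bar>u s y\<bar>\<bar> \<le> G s" for y
        using G[of s y] s by auto
    qed (use s in auto)
    finally show "\<bar>dx_heat_sg (t - s) (\<lambda>y. \<bar>u s y\<bar>) (x + h)
        - dx_heat_sg (t - s) (\<lambda>y. \<bar>u s y\<bar>) x\<bar> \<le> G s * (1 / (sqrt pi * sqrt (t - s)))" .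
  qed
  finally show ?thesis .
qed

text \<open>Follows from pi > 3, as (50/29)^2 = 2500/841 lies below 3.\<close>

lemma inverse_sqrt_pi_le: "1 / sqrt pi \<le> 29 / 50"
proof -
  have "(50 / 29)\<^sup>2 \<le> pi"
    using pi_gt3 by (simp add: power2_eq_square)
  then have "50 / 29 \<le> sqrt pi"
    by (rule real_le_rsqrt)
  then show ?thesis
    by (simp add: field_simps)
qed

text \<open>The weight nearly reproduces itself under the Duhamel integral: its constant 127/100 is
  1, from the linear flow, plus the 27/100 obtained here. The Beta integral contributes 1/12 at
  every time.\<close>

lemma duhamel_weight_integral:
  assumes "0 < t" "t \<le> 1 / 64" "0 \<le> c"
  shows "set_integrable lborel {0<..<t}
      (\<lambda>s. c * (127 / 100 + 1 / (12 * sqrt pi * sqrt s)) * (1 / (sqrt pi * sqrt (t - s))))"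
    and "(LINT s:{0<..<t}|lborel.
      c * (127 / 100 + 1 / (12 * sqrt pi * sqrt s)) * (1 / (sqrt pi * sqrt (t - s)))) \<le> c * (27 / 100)"
proof -
  have eq: "c * (127 / 100 + 1 / (12 * sqrt pi * sqrt s)) * (1 / (sqrt pi * sqrt (t - s)))
      = c * (127 / 100) / sqrt pi * (1 / sqrt (t - s)) + c / (12 * pi) * (1 / (sqrt s * sqrt (t - s)))" for s
  proof -
    have "pi = sqrt pi * sqrt pi" by simp
    then have "c / (12 * pi) = c / 12 * (1 / sqrt pi) * (1 / sqrt pi)"
      by (metis (no_types, lifting) divide_divide_eq_left times_divide_eq_right mult.right_neutral)
    then show ?thesis by (simp add: algebra_simps)
  qed
  note i1 = integral_inverse_sqrt_reflected[OF assms(1)]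
    and i2 = integral_inverse_sqrt_product[OF assms(1)]
  show "set_integrable lborel {0<..<t}
      (\<lambda>s. c * (127 / 100 + 1 / (12 * sqrt pi * sqrt s)) * (1 / (sqrt pi * sqrt (t - s))))"
    unfolding eq by (intro set_integral_add set_integrable_mult_right impI i1 i2)
  have "(LINT s:{0<..<t}|lborel.
      c * (127 / 100 + 1 / (12 * sqrt pi * sqrt s)) * (1 / (sqrt pi * sqrt (t - s))))
    = c * (127 / 100) / sqrt pi * (2 * sqrt t) + c / (12 * pi) * pi"
    unfolding eq
    by (subst set_integral_add(2))
      (simp_all only: set_integral_mult_right i1 i2 set_integrable_mult_right)
  also have "\<dots> = c * (127 / 50 * (1 / sqrt pi * sqrt t) + 1 / 12)"
    by (simp add: algebra_simps)
  also have "\<dots> \<le> c * (27 / 100)"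
  proof (rule mult_left_mono[OF _ assms(3)])
    have "sqrt t \<le> 1 / 8"
      using assms(2) by (intro real_le_lsqrt) (auto simp: power2_eq_square)
    then have "1 / sqrt pi * sqrt t \<le> 29 / 50 * (1 / 8)"
      using inverse_sqrt_pi_le assms(1) by (intro mult_mono) auto
    then show "127 / 50 * (1 / sqrt pi * sqrt t) + 1 / 12 \<le> 27 / 100"
      by simp
  qed
  finally show "(LINT s:{0<..<t}|lborel.
      c * (127 / 100 + 1 / (12 * sqrt pi * sqrt s)) * (1 / (sqrt pi * sqrt (t - s)))) \<le> c * (27 / 100)" .
qed

text \<open>A singular Gronwall argument: with weight
  \<open>W t = a h (127/100 + 1 / (12 sqrt (pi t)))\<close>, a bound \<open>M W\<close> on the increments improves to
  \<open>(1 + 27/127 (M - 1)) W\<close>, so iterating from the crude bound given by boundedness of \<open>u\<close> yields \<open>W\<close>.\<close>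
lemma mild_solution_increment_le:
  assumes u: "mild_solution u0 u" and meas: "case_prod u \<in> borel_measurable (borel \<Otimes>\<^sub>M borel)"
    and "0 < a" "0 < h"
    and lin: "\<And>t x. 0 < t \<Longrightarrow>
      \<bar>heat_sg t u0 (x + h) - heat_sg t u0 x\<bar> \<le> a * h * (1 + 1 / (12 * sqrt pi * sqrt t))"
    and "0 < t" "t \<le> 1 / 64"
  shows "\<bar>u t (x + h) - u t x\<bar> \<le> a * h * (127 / 100 + 1 / (12 * sqrt pi * sqrt t))"
proof -
  define W where "W = (\<lambda>t. a * h * (127 / 100 + 1 / (12 * sqrt pi * sqrt t)))"
  have W_ge: "a * h * (127 / 100) \<le> W t" if "0 < t" for t
    using \<open>0 < a\<close> \<open>0 < h\<close> that unfolding W_def by (intro mult_left_mono) auto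
  obtain B where B: "\<And>s y. 0 \<le> s \<Longrightarrow> s \<le> 1 / 64 \<Longrightarrow> \<bar>u s y\<bar> \<le> B"
    using mild_solution_bounded[OF u, of "1/64"] by auto
  have "0 \<le> B" using B[of 0 0] by simp
  \<comment> \<open>Chosen so that the crude bound \<open>2 * B\<close> on increments is
    \<open>M\<close> times a lower bound of \<open>W\<close>.\<close>
  define M where "M = 2 * B / (a * h * (127 / 100))"
  have "0 \<le> M" using \<open>0 \<le> B\<close> \<open>0 < a\<close> \<open>0 < h\<close> by (simp add: M_def)
  have iter: "\<bar>u t (x + h) - u t x\<bar> \<le> (1 + (27 / 127) ^ n * M) * W t"
    if "0 < t" "t \<le> 1 / 64" for n t x
    using that
  proof (induction n arbitrary: t x)
    case 0
    have "\<bar>u t (x + h) - u t x\<bar> \<le> 2 * B"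
      using B[of t "x + h"] B[of t x] 0 by linarith
    also have "\<dots> = M * (a * h * (127 / 100))"
      using \<open>0 < a\<close> \<open>0 < h\<close> by (simp add: M_def)
    also have "\<dots> \<le> (1 + M) * W t"
      using W_ge[OF 0(1)] \<open>0 \<le> M\<close> \<open>0 < a\<close> \<open>0 < h\<close> by (intro mult_mono) auto
    finally show ?case by simp
  next
    case (Suc n)
    define c where "c = (1 + (27 / 127) ^ n * M) * (a * h)"
    have "0 \<le> c" using \<open>0 \<le> M\<close> \<open>0 < a\<close> \<open>0 < h\<close> by (simp add: c_def)
    have G: "\<bar>u s (y + h) - u s y\<bar> \<le> c * (127 / 100 + 1 / (12 * sqrt pi * sqrt s))"
      if "0 < s" "s < t" for s y
      using Suc.IH[of s y] Suc.prems that by (simp add: c_def W_def mult.assoc)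
    have "\<bar>u t (x + h) - u t x\<bar> \<le> \<bar>heat_sg t u0 (x + h) - heat_sg t u0 x\<bar>
      + \<bar>(LINT s:{0<..<t}|lborel. dx_heat_sg (t - s) (\<lambda>y. \<bar>u s y\<bar>) (x + h))
        - (LINT s:{0<..<t}|lborel. dx_heat_sg (t - s) (\<lambda>y. \<bar>u s y\<bar>) x)\<bar>"
      unfolding mild_solution_duhamel[OF u Suc.prems(1)] by linarith
    also have "\<dots> \<le> a * h * (1 + 1 / (12 * sqrt pi * sqrt t)) + c * (27 / 100)"
    proof (rule add_mono[OF lin[OF Suc.prems(1)]])
      have "\<bar>u s y\<bar> \<le> B" if "0 < s" "s < t" for s y
        using B Suc.prems(2) that by simp
      from order_trans[OF duhamel_increment_le[OF Suc.prems(1) meas this G]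
          duhamel_weight_integral(2)[OF Suc.prems \<open>0 \<le> c\<close>]]
      show "\<bar>(LINT s:{0<..<t}|lborel. dx_heat_sg (t - s) (\<lambda>y. \<bar>u s y\<bar>) (x + h))
          - (LINT s:{0<..<t}|lborel. dx_heat_sg (t - s) (\<lambda>y. \<bar>u s y\<bar>) x)\<bar> \<le> c * (27 / 100)"
        using duhamel_weight_integral(1)[OF Suc.prems \<open>0 \<le> c\<close>] by blast
    qed
    \<comment> \<open>Since 27/100 = 27/127 * 127/100, the excess over \<open>W\<close> shrinks by
      the factor 27/127, and 1 + 27/100 = 127/100 restores \<open>W\<close>.\<close>
    also have "\<dots> = W t + (27 / 127) ^ Suc n * M * (a * h * (127 / 100))"
      by (simp add: W_def c_def algebra_simps)
    also have "\<dots> \<le> W t + (27 / 127) ^ Suc n * M * W t"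
      using W_ge[OF Suc.prems(1)] \<open>0 \<le> M\<close> by (intro add_left_mono mult_left_mono) auto
    also have "\<dots> = (1 + (27 / 127) ^ Suc n * M) * W t"
      by (simp add: algebra_simps)
    finally show ?case .
  qed
  have "(\<lambda>n. (1 + (27 / 127) ^ n * M) * W t) \<longlonglongrightarrow> (1 + 0 * M) * W t"
    by (intro tendsto_intros LIMSEQ_power_zero) auto
  then have "\<bar>u t (x + h) - u t x\<bar> \<le> (1 + 0 * M) * W t"
    using iter assms(6,7) by (intro LIMSEQ_le_const) auto
  then show ?thesis by (simp add: W_def)
qed

section \<open>Uniqueness of the zero at time 1/64\<close>

text \<open>Between two zeros the drop of the flow of the profile would have to be compensated by
  the rise of the other two contributions, whose increments are too small.\<close>

lemma mild_solution_near_phi_prof_zero_unique: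
  assumes u: "mild_solution u0 u" and meas: "case_prod u \<in> borel_measurable (borel \<Otimes>\<^sub>M borel)"
    and "0 < a" and near: "\<And>x. \<bar>u0 x - phi_prof a (x - m)\<bar> \<le> a / 12"
    and zero: "u (1 / 64) \<xi> = 0" "u (1 / 64) \<eta> = 0"
  shows "\<not> \<xi> < \<eta>"
proof
  assume "\<xi> < \<eta>"
  define T :: real where "T = 1 / 64"
  define \<kappa> where "\<kappa> = 1 / sqrt pi"
  have T: "0 < T" and sqrtT: "sqrt T = 1 / 8"
    by (auto simp: T_def real_sqrt_divide real_sqrt_unique)
  have \<kappa>: "0 \<le> \<kappa>" "\<kappa> \<le> 29 / 50"
    using inverse_sqrt_pi_le by (auto simp: \<kappa>_def)
  define psi where "psi = (\<lambda>x. phi_prof a (x - m))"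
  have "Cub u0"
    using u unfolding mild_solution_def by force
  then have u0 [measurable]: "u0 \<in> borel_measurable borel"
    by (rule Cub_measurable)
  obtain B where B: "\<And>y. \<bar>u0 y\<bar> \<le> B"
    using Cub_bounded[OF \<open>Cub u0\<close>] by blast
  have psi [measurable]: "psi \<in> borel_measurable borel"
    unfolding psi_def by measurable
  have psi_le: "\<bar>psi y\<bar> \<le> a" for y
    using abs_phi_prof_le \<open>0 < a\<close> by (simp add: psi_def)
  have [measurable]: "(\<lambda>y. u0 y - psi y) \<in> borel_measurable borel"
    by measurable
  have near': "\<bar>u0 y - psi y\<bar> \<le> a / 12" for y
    using near by (simp add: psi_def)
  \<comment> \<open>\<open>psi\<close> is Lipschitz with constant \<open>a\<close>, while the
    remainder is controlled in size by \<open>a / 12\<close>; each part gets its own increment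
    estimate.\<close>
  have split: "heat_sg t u0 x = heat_sg t psi x + heat_sg t (\<lambda>y. u0 y - psi y) x"
    if "0 < t" for t x
    using heat_sg_diff[OF that u0 B psi psi_le] by simp
  have psi_heat: "heat_sg t psi x = heat_sg t (phi_prof a) (x - m)" for t x
    using heat_sg_translate[of t "phi_prof a" x "- m"] by (simp add: psi_def)
  have diff_heat: "\<bar>heat_sg t (\<lambda>y. u0 y - psi y) (x + h) - heat_sg t (\<lambda>y. u0 y - psi y) x\<bar>
      \<le> a * h * (1 / (12 * sqrt pi * sqrt t))" if "0 < t" "0 < h" for t h x
    using heat_sg_increment_le[OF that(1) _ near' that(2), where x = x] by (simp add: mult_ac)
  have lin: "\<bar>heat_sg t u0 (x + h) - heat_sg t u0 x\<bar> \<le> a * h * (1 + 1 / (12 * sqrt pi * sqrt t))"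
    if "0 < t" "0 < h" for t h x
  proof -
    have "\<bar>psi (y + h) - psi y\<bar> \<le> a * h" for y
      using phi_prof_diff_le[of a "y - m" "y + h - m"] \<open>0 < a\<close> that by (simp add: psi_def)
    then have "\<bar>heat_sg t psi (x + h) - heat_sg t psi x\<bar> \<le> a * h"
      by (rule heat_sg_increment_le_modulus[OF that(1) psi psi_le])
    with diff_heat[OF that, of x] show ?thesis
      unfolding split[OF that(1)] by (simp add: distrib_left)
  qed
  note incr = mild_solution_increment_le[OF u meas \<open>0 < a\<close> _ lin]
  obtain C where C: "\<And>s y. 0 \<le> s \<Longrightarrow> s \<le> T \<Longrightarrow> \<bar>u s y\<bar> \<le> C"
    using mild_solution_bounded[OF u, of T] T by auto
  define N where "N = (\<lambda>x. LINT s:{0<..<T}|lborel. dx_heat_sg (T - s) (\<lambda>y. \<bar>u s y\<bar>) x)"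
  have uT: "u T x = heat_sg T psi x + heat_sg T (\<lambda>y. u0 y - psi y) x + N x" for x
    unfolding N_def mild_solution_duhamel[OF u T] split[OF T] ..
  \<comment> \<open>Using the Lipschitz constant \<open>L s\<close> of the solution avoids the
    factor \<open>1 / sqrt (T - s)\<close> and leaves only the integrable singularity at
    \<open>s = 0\<close>.\<close>
  have N_le: "\<bar>N x\<bar> \<le> a * (1 / 30)" for x
  proof -
    define L where "L = (\<lambda>s. a * (127 / 100 + 1 / (12 * sqrt pi * sqrt s)))"
    have L: "L = (\<lambda>s. a * (127 / 100) + a * \<kappa> / 12 * (1 / sqrt s))"
      by (auto simp: L_def \<kappa>_def algebra_simps)
    note i = integral_inverse_sqrt[OF T]
    have const: "set_integrable lborel {0<..<T} (\<lambda>s. a * (127 / 100))"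
      unfolding set_integrable_def using T
      by (intro integrable_scaleR_left integrable_real_indicator) auto
    have int: "set_integrable lborel {0<..<T} L"
      unfolding L by (intro set_integral_add set_integrable_mult_right impI i const)
    have "\<bar>N x\<bar> \<le> (LINT s:{0<..<T}|lborel. L s)"
      unfolding N_def
    proof (rule set_integral_abs_le[OF _ int])
      have [measurable]: "case_prod u \<in> borel_measurable (borel \<Otimes>\<^sub>M borel)"
        by (rule meas)
      show "set_integrable lborel {0<..<T} (\<lambda>s. dx_heat_sg (T - s) (\<lambda>y. \<bar>u s y\<bar>) x)"
        using C by (intro set_integrable_duhamel[OF T, where B = C]) auto
      fix s assume s: "s \<in> {0<..<T}"
      have [measurable]: "u s \<in> borel_measurable borel"
        using u s unfolding mild_solution_def by (intro Cub_measurable) auto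
      show "\<bar>dx_heat_sg (T - s) (\<lambda>y. \<bar>u s y\<bar>) x\<bar> \<le> L s"
      proof (rule dx_heat_sg_le_lipschitz[where B = C])
        fix y h :: real assume "0 < h"
        then have "\<bar>u s (y + h) - u s y\<bar> \<le> L s * h"
          using incr[of h s y] s by (simp add: L_def T_def mult_ac)
        then show "\<bar>\<bar>u s (y + h)\<bar> - \<bar>u s y\<bar>\<bar> \<le> L s * h"
          by linarith
      qed (use s C in auto)
    qed
    also have "\<dots> = a * (127 / 100) * T + a * \<kappa> / 12 * (2 * sqrt T)"
    proof -
      have "(LINT s:{0<..<T}|lborel. a * (127 / 100)) = a * (127 / 100) * T"
        using T by (simp add: set_lebesgue_integral_def)
      then show ?thesis
        unfolding L using const i
        by (subst set_integral_add(2)) (simp_all only: set_integral_mult_right set_integrable_mult_right)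
    qed
    also have "\<dots> = a * (127 / 6400 + \<kappa> / 48)"
      unfolding sqrtT by (simp add: T_def algebra_simps)
    \<comment> \<open>With \<kappa> at most 29/50 the bracket is below 0.032.\<close>
    also have "\<dots> \<le> a * (1 / 30)"
      using \<open>0 < a\<close> \<kappa> by (intro mult_left_mono) auto
    finally show ?thesis .
  qed
  have c: "1 - 2 * sqrt T / sqrt pi = 1 - \<kappa> / 4"
    by (simp add: sqrtT \<kappa>_def)
  \<comment> \<open>At a zero the flow of \<open>psi\<close> is balanced by the other two terms, of
    total size at most 1/12 + 1/30 = 7/60 times \<open>a\<close>.\<close>
  have loc: "(1 - \<kappa> / 4) * \<bar>psi x\<bar> \<le> a * (7 / 60)" if "u T x = 0" for x
  proof -
    have "(1 - \<kappa> / 4) * \<bar>psi x\<bar> \<le> \<bar>heat_sg T psi x\<bar>"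
      using abs_heat_sg_phi_prof_ge[OF T, of a "x - m"] \<open>0 < a\<close>
      unfolding c psi_heat by (simp add: psi_def)
    also have "\<dots> \<le> \<bar>heat_sg T (\<lambda>y. u0 y - psi y) x\<bar> + \<bar>N x\<bar>"
      using uT[of x] that by linarith
    also have "\<dots> \<le> a / 12 + a * (1 / 30)"
      by (intro add_mono N_le heat_sg_le[OF T _ near']) measurable
    finally show ?thesis by simp
  qed
  define h where "h = \<eta> - \<xi>"
  have "0 < h" "\<eta> = \<xi> + h" using \<open>\<xi> < \<eta>\<close> by (auto simp: h_def)
  obtain z where z: "\<xi> - m < z" "z < \<eta> - m"
    "phi_prof a (\<xi> - m) - phi_prof a (\<eta> - m) = (\<eta> - m - (\<xi> - m)) * (a * exp (- \<bar>z\<bar>))"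
    using phi_prof_diff[of "\<xi> - m" "\<eta> - m"] \<open>\<xi> < \<eta>\<close> by auto
  have "(1 - \<kappa> / 4) * (a * (1 - exp (- \<bar>z\<bar>))) \<le> a * (7 / 60)"
  proof -
    \<comment> \<open>The mean value point is no farther from the centre than one of the zeros, and
      the profile grows in modulus away from the centre, so \<open>loc\<close> at that zero bounds
      the flattening at \<open>z\<close>.\<close>
    have "\<bar>z\<bar> \<le> \<bar>\<xi> - m\<bar> \<or> \<bar>z\<bar> \<le> \<bar>\<eta> - m\<bar>" using z by linarith
    then obtain x where x: "u T x = 0" "\<bar>z\<bar> \<le> \<bar>x - m\<bar>"
      using zero by (auto simp: T_def)
    have "a * (1 - exp (- \<bar>z\<bar>)) \<le> \<bar>psi x\<bar>"
      using x(2) \<open>0 < a\<close> by (simp add: psi_def abs_phi_prof)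
    then have "(1 - \<kappa> / 4) * (a * (1 - exp (- \<bar>z\<bar>))) \<le> (1 - \<kappa> / 4) * \<bar>psi x\<bar>"
      using \<kappa> by (intro mult_left_mono) auto
    with loc[OF x(1)] show ?thesis by linarith
  qed
  then have "a * (1 - \<kappa> / 4 - 7 / 60) \<le> (1 - \<kappa> / 4) * (a * exp (- \<bar>z\<bar>))"
    by (simp add: algebra_simps)
  from mult_left_mono[OF this less_imp_le[OF \<open>0 < h\<close>]]
  have "a * h * (1 - \<kappa> / 4 - 7 / 60) \<le> (1 - \<kappa> / 4) * (psi \<xi> - psi \<eta>)"
    using z(3) by (simp add: psi_def h_def mult_ac)
  also have "\<dots> \<le> heat_sg T psi \<xi> - heat_sg T psi \<eta>"
    using heat_sg_phi_prof_diff[OF T, of a "\<xi> - m" "\<eta> - m"] \<open>0 < a\<close> \<open>\<xi> < \<eta>\<close>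
    unfolding c psi_heat by (simp add: psi_def)
  \<comment> \<open>The three contributions to \<open>u T\<close> sum to zero at both
    points.\<close>
  also have "\<dots> = (heat_sg T (\<lambda>y. u0 y - psi y) \<eta> - heat_sg T (\<lambda>y. u0 y - psi y) \<xi>) + (N \<eta> - N \<xi>)"
    using uT[of \<xi>] uT[of \<eta>] zero by (simp add: T_def)
  also have "\<dots> \<le> a * h * (2 * \<kappa> / 3) + a * h * (27 / 100)"
  proof (rule add_mono)
    \<comment> \<open>At \<open>sqrt T = 1 / 8\<close> the smoothing factor is \<kappa> * 8 /
      12.\<close>
    show "heat_sg T (\<lambda>y. u0 y - psi y) \<eta> - heat_sg T (\<lambda>y. u0 y - psi y) \<xi> \<le> a * h * (2 * \<kappa> / 3)"
      using diff_heat[OF T \<open>0 < h\<close>, of \<xi>] \<open>\<eta> = \<xi> + h\<close> by (simp add: sqrtT \<kappa>_def)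
    have ah: "0 \<le> a * h" using \<open>0 < a\<close> \<open>0 < h\<close> by simp
    have G: "\<bar>u s (y + h) - u s y\<bar> \<le> a * h * (127 / 100 + 1 / (12 * sqrt pi * sqrt s))"
      if "0 < s" "s < T" for s y
      using incr[of h s y] \<open>0 < h\<close> that by (simp add: T_def)
    have "\<bar>N (\<xi> + h) - N \<xi>\<bar> \<le> a * h * (27 / 100)"
    proof -
      have "T \<le> 1 / 64" by (simp add: T_def)
      note w = duhamel_weight_integral[OF T this ah]
      have "\<bar>u s y\<bar> \<le> C" if "0 < s" "s < T" for s y
        using C that by simp
      from order_trans[OF duhamel_increment_le[OF T meas this G w(1)] w(2)]
      show ?thesis unfolding N_def by blast
    qed
    then show "N \<eta> - N \<xi> \<le> a * h * (27 / 100)"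
      unfolding \<open>\<eta> = \<xi> + h\<close> by linarith
  qed
  finally have "a * h * (1 - \<kappa> / 4 - 7 / 60) \<le> a * h * (2 * \<kappa> / 3 + 27 / 100)"
    by (simp add: distrib_left)
  then have "1 - \<kappa> / 4 - 7 / 60 \<le> 2 * \<kappa> / 3 + 27 / 100"
    using \<open>0 < a\<close> \<open>0 < h\<close> by simp
  \<comment> \<open>For \<kappa> = 29/50, the worst case, the left side is about 0.738 and the right
    side about 0.657.\<close>
  then show False using \<kappa> by simp
qed

theorem theorem3p9:
  fixes phis x0 x1 :: real and u0 :: "real \<Rightarrow> real" and u :: "real \<Rightarrow> real \<Rightarrow> real"
  assumes "regularity_hypothesis"
    and "phis > 0"
    and "0 < x1 - x0" and "x1 - x0 < 1/6"
    and "C1ub u0"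
    and "\<forall>x. phi_prof phis (x - x0) \<le> u0 x \<and> u0 x \<le> phi_prof phis (x - x1)"
    and "mild_solution u0 u"
  shows "\<not> (\<exists>\<xi>1 \<xi>2 :: real \<Rightarrow> real.
            continuous_on {0..} \<xi>1 \<and> continuous_on {0..} \<xi>2 \<and>
            (\<forall>t\<ge>0. \<xi>1 t < \<xi>2 t \<and> simple_zero (u t) (\<xi>1 t) \<and> simple_zero (u t) (\<xi>2 t) \<and>
                    (\<forall>x. \<xi>1 t < x \<and> x < \<xi>2 t \<longrightarrow> u t x \<noteq> 0)))"
proof safe
  fix \<xi>1 \<xi>2 :: "real \<Rightarrow> real"
  assume "\<forall>t\<ge>0. \<xi>1 t < \<xi>2 t \<and> simple_zero (u t) (\<xi>1 t) \<and> simple_zero (u t) (\<xi>2 t) \<and>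
    (\<forall>x. \<xi>1 t < x \<and> x < \<xi>2 t \<longrightarrow> u t x \<noteq> 0)"
  then have zeros: "\<xi>1 (1 / 64) < \<xi>2 (1 / 64)" "u (1 / 64) (\<xi>1 (1 / 64)) = 0"
    "u (1 / 64) (\<xi>2 (1 / 64)) = 0"
    by (auto simp: simple_zero_def)
  \<comment> \<open>Each barrier is the centred profile translated by less than 1/12, and the
    profile is Lipschitz with constant \<open>phis\<close>.\<close>
  have "\<bar>u0 x - phi_prof phis (x - (x0 + x1) / 2)\<bar> \<le> phis / 12" for x
  proof -
    have "phi_prof phis (x - (x0 + x1) / 2) - phi_prof phis (x - x0) \<le> phis * ((x1 - x0) / 2)"
      "phi_prof phis (x - x1) - phi_prof phis (x - (x0 + x1) / 2) \<le> phis * ((x1 - x0) / 2)"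
      using phi_prof_diff_le(2)[of phis "x - (x0 + x1) / 2" "x - x0"]
        phi_prof_diff_le(2)[of phis "x - x1" "x - (x0 + x1) / 2"] assms(2,3)
      by (auto simp: field_simps)
    moreover have "phis * ((x1 - x0) / 2) \<le> phis * (1 / 12)"
      using assms by (intro mult_left_mono) auto
    moreover have "phi_prof phis (x - x0) \<le> u0 x" "u0 x \<le> phi_prof phis (x - x1)"
      using assms(6) by auto
    ultimately show ?thesis by linarith
  qed
  \<comment> \<open>The clamped solution agrees with \<open>u\<close> at time 1/64, so the zeros
    carry over.\<close>
  then show False
    using mild_solution_near_phi_prof_zero_unique[OF mild_solution_extend[OF assms(7)]
        mild_solution_measurable[OF assms(7)] assms(2), of "(x0 + x1) / 2"] zeros
    by fastforce
qed

end
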